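(* There exist a countable group $G$ that is not finitely generated and a continuous action of $G$ on the Cantor set that is minimal, distal and expansive.
   Context: $G$ is regarded as a discrete group. A continuous action $(X,G)$ of $G$ on a compact metric space $(X,d)$ is a group homomorphism $\phi\colon G\to \mathrm{Homeo}(X)$; write $gx=\phi(g)(x)$. The action is minimal if $X$ has no proper nonempty $G$-invariant closed subset (equivalently, every orbit $Gx$ is dense in $X$). The action is distal if $\inf_{g\in G} d(gx,gy)>0$ for all $x\neq y$ in $X$. The action is expansive if there is a constant $c>0$ such that $\sup_{g\in G} d(gx,gy)>c$ for all $x\neq y$ in $X$. *)

theory Defs
  imports "HOL-Analysis.Analysis" "HOL-Algebra.Bij" "HOL-Algebra.Generated_Groups"
begin

text \<open>The middle-thirds Cantor set, i.e. the points of the unit interval having a ternary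
  expansion without the digit 1, with the metric of the real line.\<close>

definition cantor_set :: "real set" where
  "cantor_set = range (\<lambda>a :: nat \<Rightarrow> bool. \<Sum>n. 2 * of_bool (a n) / 3 ^ Suc n)"

definition finitely_generated_group :: "('g, 'm) monoid_scheme \<Rightarrow> bool" where
  "finitely_generated_group G \<longleftrightarrow>
     group G \<and> (\<exists>S. finite S \<and> S \<subseteq> carrier G \<and> generate G S = carrier G)"

text \<open>As in \<^const>\<open>BijGroup\<close>, maps are extensional, so that a self-homeomorphism of
  \<open>X\<close> is represented by exactly one HOL function.\<close>

definition Homeo :: "'a::topological_space set \<Rightarrow> ('a \<Rightarrow> 'a) monoid" where
  "Homeo X = (BijGroup X)\<lparr>carrier := {f \<in> extensional X. \<exists>f'. homeomorphism X X f f'}\<rparr>"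

definition continuous_action ::
  "('g, 'm) monoid_scheme \<Rightarrow> 'a::metric_space set \<Rightarrow> ('g \<Rightarrow> 'a \<Rightarrow> 'a) \<Rightarrow> bool" where
  "continuous_action G X \<phi> \<longleftrightarrow> group G \<and> compact X \<and> \<phi> \<in> hom G (Homeo X)"

definition minimal_action ::
  "('g, 'm) monoid_scheme \<Rightarrow> 'a::metric_space set \<Rightarrow> ('g \<Rightarrow> 'a \<Rightarrow> 'a) \<Rightarrow> bool" where
  "minimal_action G X \<phi> \<longleftrightarrow>
     (\<forall>Y. closedin (top_of_set X) Y \<and> Y \<noteq> {} \<and> (\<forall>g\<in>carrier G. \<phi> g ` Y \<subseteq> Y) \<longrightarrow> Y = X)"

text \<open>The real-valued infimum and supremum below are only meaningful for a nonempty, bounded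
  family; this holds for every \<^const>\<open>continuous_action\<close>, since \<open>X\<close> is compact.\<close>

definition distal_action ::
  "('g, 'm) monoid_scheme \<Rightarrow> 'a::metric_space set \<Rightarrow> ('g \<Rightarrow> 'a \<Rightarrow> 'a) \<Rightarrow> bool" where
  "distal_action G X \<phi> \<longleftrightarrow>
     (\<forall>x\<in>X. \<forall>y\<in>X. x \<noteq> y \<longrightarrow> (INF g\<in>carrier G. dist (\<phi> g x) (\<phi> g y)) > 0)"

definition expansive_action ::
  "('g, 'm) monoid_scheme \<Rightarrow> 'a::metric_space set \<Rightarrow> ('g \<Rightarrow> 'a \<Rightarrow> 'a) \<Rightarrow> bool" where
  "expansive_action G X \<phi> \<longleftrightarrow>
     (\<exists>c>0. \<forall>x\<in>X. \<forall>y\<in>X. x \<noteq> y \<longrightarrow> (SUP g\<in>carrier G. dist (\<phi> g x) (\<phi> g y)) > c)"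

text \<open>\<^const>\<open>Homeo\<close> is indeed a group, with the multiplication inherited from \<^const>\<open>BijGroup\<close>.\<close>

lemma Homeo_carrier_subset: "{f \<in> extensional X. \<exists>f'. homeomorphism X X f f'} \<subseteq> Bij X"
  by (auto simp: Bij_def bij_betw_def homeomorphism_def intro: inj_on_inverseI)

lemma group_Homeo: "group (Homeo X)"
proof -
  interpret B: group "BijGroup X" by (rule group_BijGroup)
  let ?H = "{f \<in> extensional X. \<exists>f'. homeomorphism X X f f'}"
  have sub: "?H \<subseteq> Bij X" by (rule Homeo_carrier_subset)
  have "subgroup ?H (BijGroup X)"
  proof (rule B.subgroupI)
    show "?H \<subseteq> carrier (BijGroup X)" using sub by (simp add: BijGroup_def)
    have "homeomorphism X X (\<lambda>x\<in>X. x) id"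
      by (auto simp: homeomorphism_def)
    then show "?H \<noteq> {}" by (metis (no_types, lifting) empty_iff mem_Collect_eq restrict_extensional)
  next
    fix f assume f: "f \<in> ?H"
    then obtain f' where f': "homeomorphism X X f f'" by blast
    have inv: "inv\<^bsub>BijGroup X\<^esub> f = (\<lambda>x\<in>X. inv_into X f x)"
      using f sub by (intro inv_BijGroup) auto
    have "inv_into X f x = f' x" if "x \<in> X" for x
    proof (rule inv_into_f_eq)
      show "inj_on f X" using f' by (metis homeomorphism_def inj_on_inverseI)
      show "f' x \<in> X" using f' that by (metis homeomorphism_def imageI)
      show "f (f' x) = x" using f' that by (simp add: homeomorphism_def)
    qed
    then have "homeomorphism X X (\<lambda>x\<in>X. inv_into X f x) f"
      by (intro homeomorphism_cong[OF homeomorphism_symD[OF f']]) auto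
    then show "inv\<^bsub>BijGroup X\<^esub> f \<in> ?H" unfolding inv mem_Collect_eq by (metis restrict_extensional)
  next
    fix f g assume f: "f \<in> ?H" and g: "g \<in> ?H"
    then obtain f' g' where f': "homeomorphism X X f f'" and g': "homeomorphism X X g g'" by blast
    have eq: "f \<otimes>\<^bsub>BijGroup X\<^esub> g = compose X f g"
      using f g sub by (auto simp: BijGroup_def)
    have "homeomorphism X X (compose X f g) (g' \<circ> f')"
      by (rule homeomorphism_cong[OF homeomorphism_compose[OF g' f']]) (auto simp: compose_def)
    then show "f \<otimes>\<^bsub>BijGroup X\<^esub> g \<in> ?H" unfolding eq mem_Collect_eq using compose_extensional by blast
  qed
  then show ?thesis unfolding Homeo_def by (rule B.subgroup_imp_group)
qed

end

theory Submission
  imports Defs "HOL-Algebra.Weak_Morphisms"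
begin

text \<open>On \<open>\<bool>\<^sup>\<nat> \<times> \<bool>\<close>, which is a Cantor set, let the group consist of the skew products
  \<open>(y, s) \<mapsto> (y + h, s + f y)\<close> with \<open>h\<close> of finite support and \<open>f\<close> locally constant. Translations
  by finitely supported \<open>h\<close> and the flip of the fibre make the action minimal. Points with
  different bases keep a fixed coordinate of the base apart, and points over the same base
  keep their fibre coordinates apart: the action is distal. A suitable \<open>f\<close> turns any difference
  in the base into a difference in the fibre: the action is expansive. The group is an increasing
  union of proper subgroups, those using only the first \<open>n\<close> base coordinates, so it is not
  finitely generated.\<close>

section \<open>Ternary coding of binary sequences and its metric estimates\<close>

definition cantor_map :: "(nat \<Rightarrow> bool) \<Rightarrow> real" where
  "cantor_map a = (\<Sum>n. 2 * of_bool (a n) / 3 ^ Suc n)"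

lemma cantor_set_eq: "cantor_set = range cantor_map"
  by (simp add: cantor_set_def cantor_map_def[abs_def])

lemma sums_ternary_tail: "(\<lambda>n. 2 / 3 ^ Suc (n + m) :: real) sums (1 / 3 ^ m)"
proof -
  have "(\<lambda>n. (2 / 3 ^ Suc m) * (1 / 3) ^ n :: real) sums ((2 / 3 ^ Suc m) * (1 / (1 - 1 / 3)))"
    by (intro sums_mult geometric_sums) simp
  then show ?thesis
    by (simp add: power_add power_divide field_simps)
qed

lemma summable_cantor: "summable (\<lambda>n. 2 * of_bool (a n) / 3 ^ Suc n :: real)"
  by (rule summable_comparison_test'[OF sums_summable[OF sums_ternary_tail[of 0]]])
    (auto simp: divide_simps)

text \<open>Digits differ by at most 1, so the terms from index \<open>m\<close> on are dominated by
  a geometric tail with sum \<open>1 / 3 ^ m\<close>. Both distance estimates follow from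
  this.\<close>

lemma cantor_map_diff_approx:
  "\<bar>cantor_map a - cantor_map b - (\<Sum>n<m. 2 * (of_bool (a n) - of_bool (b n)) / 3 ^ Suc n)\<bar> \<le> 1 / 3 ^ m"
proof -
  define d :: "nat \<Rightarrow> real" where "d n = 2 * (of_bool (a n) - of_bool (b n)) / 3 ^ Suc n" for n
  have d: "d = (\<lambda>n. 2 * of_bool (a n) / 3 ^ Suc n - 2 * of_bool (b n) / 3 ^ Suc n)"
    by (simp add: d_def fun_eq_iff diff_divide_distrib right_diff_distrib)
  have "summable d" and "cantor_map a - cantor_map b = suminf d"
    unfolding d cantor_map_def
    by (intro summable_diff summable_cantor suminf_diff)+
  then have "cantor_map a - cantor_map b - (\<Sum>n<m. d n) = (\<Sum>n. d (n + m))"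
    using suminf_split_initial_segment[of d m] by simp
  also have "norm \<dots> \<le> (\<Sum>n. 2 / 3 ^ Suc (n + m))"
    by (intro norm_suminf_le sums_summable[OF sums_ternary_tail]) (auto simp: d_def divide_simps)
  also have "\<dots> = 1 / 3 ^ m"
    using sums_ternary_tail[of m] by (rule sums_unique[symmetric])
  finally show ?thesis
    by (simp add: d_def)
qed

lemma dist_cantor_map_le:
  assumes "\<And>i. i < m \<Longrightarrow> a i = b i"
  shows "dist (cantor_map a) (cantor_map b) \<le> 1 / 3 ^ m"
  using cantor_map_diff_approx[of a b m] assms by (simp add: dist_real_def)

text \<open>At the first index \<open>k\<close> of disagreement the term is
  \<open>2 / 3 ^ Suc k\<close> in absolute value, and the remaining tail can cancel at most half of
  it.\<close>

lemma dist_cantor_map_ge: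
  assumes "a m \<noteq> b m"
  shows "1 / 3 ^ Suc m \<le> dist (cantor_map a) (cantor_map b)"
proof -
  define k where "k = (LEAST k. a k \<noteq> b k)"
  have k: "a k \<noteq> b k" "k \<le> m"
    unfolding k_def by (rule LeastI[of _ m], rule assms, rule Least_le, rule assms)
  have eq: "a i = b i" if "i < k" for i
    using not_less_Least[OF that[unfolded k_def]] by blast
  have "(1::real) / 3 ^ Suc m \<le> 1 / 3 ^ Suc k"
    using k by (intro divide_left_mono power_increasing) auto
  also have "\<dots> \<le> dist (cantor_map a) (cantor_map b)"
  proof -
    define p :: real where "p = 1 / 3 ^ Suc k"
    have "\<bar>cantor_map a - cantor_map b - 2 * (of_bool (a k) - of_bool (b k)) * p\<bar> \<le> p"
      using cantor_map_diff_approx[of a b "Suc k"] eq by (simp add: p_def)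
    then have "p \<le> \<bar>cantor_map a - cantor_map b\<bar>"
      using k(1) by (cases "a k"; cases "b k") (simp_all add: abs_if split: if_splits)
    then show ?thesis
      by (simp add: p_def dist_real_def)
  qed
  finally show ?thesis .
qed

lemma inj_cantor_map: "inj cantor_map"
proof (rule injI, rule ccontr)
  fix a b assume *: "cantor_map a = cantor_map b" "a \<noteq> b"
  then obtain m where "a m \<noteq> b m" by blast
  from dist_cantor_map_ge[of a m b, OF this] have "1 / 3 ^ Suc m \<le> (0::real)"
    by (simp only: *(1) dist_self)
  moreover have "(0::real) < 1 / 3 ^ Suc m" by simp
  ultimately show False by linarith
qed

lemma compact_cantor_set: "compact cantor_set"
proof -
  have "compact_space (product_topology (\<lambda>i::nat. euclidean :: bool topology) UNIV)"
    by (simp add: compact_space_product_topology flip: compact_space_def)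
      (simp add: compact_space_def finite_imp_compact)
  then have "compact (UNIV :: (nat \<Rightarrow> bool) set)"
    by (simp add: euclidean_product_topology compact_space_def)
  moreover have "continuous_on UNIV cantor_map"
  \<comment> \<open>The partial sums involve finitely many coordinates, hence are continuous, and
    they converge uniformly.\<close>
  proof (rule uniform_limit_theorem[OF always_eventually])
    show "\<forall>n. continuous_on UNIV (\<lambda>a. \<Sum>k<n. 2 * of_bool (a k) / 3 ^ Suc k :: real)"
      by (intro allI continuous_intros
          continuous_on_compose2[OF Topological_Spaces.continuous_on_discrete[of UNIV of_bool]]
          continuous_on_product_coordinates) auto
    show "uniform_limit UNIV (\<lambda>n a. \<Sum>k<n. 2 * of_bool (a k) / 3 ^ Suc k) cantor_map sequentially"
      unfolding cantor_map_def
      by (rule Weierstrass_m_test[OF _ sums_summable[OF sums_ternary_tail[of 0]]])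
        (auto simp: divide_simps)
  qed simp
  ultimately show ?thesis
    unfolding cantor_set_eq by (metis compact_continuous_image)
qed

section \<open>Skew products depending on finitely many coordinates\<close>

text \<open>A sequence \<open>a\<close> encodes the point of \<open>\<bool>\<^sup>\<nat> \<times> \<bool>\<close> whose base coordinates are
  \<open>a 1, a 2, \<dots>\<close> and whose fibre coordinate is \<open>a 0\<close>.\<close>

definition skew_upto :: "nat \<Rightarrow> ((nat \<Rightarrow> bool) \<Rightarrow> nat \<Rightarrow> bool) set" where
  "skew_upto n = {T. (\<forall>a i. n < i \<longrightarrow> T a i = a i) \<and>
     (\<forall>a b i. 0 < i \<longrightarrow> (T a i = a i) = (T b i = b i)) \<and>
     (\<forall>a b. (\<forall>j. 0 < j \<longrightarrow> j \<le> n \<longrightarrow> a j = b j) \<longrightarrow> (T a 0 = a 0) = (T b 0 = b 0))}"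

lemma
  assumes "T \<in> skew_upto n"
  shows skew_upto_fix: "n < i \<Longrightarrow> T a i = a i"
    and skew_upto_base: "0 < i \<Longrightarrow> (T a i = a i) = (T b i = b i)"
    and skew_upto_fibre: "(\<And>j. 0 < j \<Longrightarrow> j \<le> n \<Longrightarrow> a j = b j) \<Longrightarrow> (T a 0 = a 0) = (T b 0 = b 0)"
proof -
  note * = assms[unfolded skew_upto_def mem_Collect_eq]
  show "n < i \<Longrightarrow> T a i = a i"
    by (rule *[THEN conjunct1, rule_format])
  show "0 < i \<Longrightarrow> (T a i = a i) = (T b i = b i)"
    by (rule *[THEN conjunct2, THEN conjunct1, rule_format])
  show "(\<And>j. 0 < j \<Longrightarrow> j \<le> n \<Longrightarrow> a j = b j) \<Longrightarrow> (T a 0 = a 0) = (T b 0 = b 0)"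
    by (rule *[THEN conjunct2, THEN conjunct2, rule_format])
qed

lemma skew_uptoI:
  assumes "\<And>a i. n < i \<Longrightarrow> T a i = a i"
    and "\<And>a b i. 0 < i \<Longrightarrow> (T a i = a i) = (T b i = b i)"
    and "\<And>a b. (\<And>j. 0 < j \<Longrightarrow> j \<le> n \<Longrightarrow> a j = b j) \<Longrightarrow> (T a 0 = a 0) = (T b 0 = b 0)"
  shows "T \<in> skew_upto n"
  unfolding skew_upto_def mem_Collect_eq
proof (intro conjI allI impI)
  show "(T a 0 = a 0) = (T b 0 = b 0)" if "\<forall>j. 0 < j \<longrightarrow> j \<le> n \<longrightarrow> a j = b j" for a b
    by (rule assms(3)) (use that in blast)
qed (fact assms)+

lemma skew_upto_mono:
  assumes "T \<in> skew_upto n" "n \<le> m"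
  shows "T \<in> skew_upto m"
proof (rule skew_uptoI)
  show "T a i = a i" if "m < i" for a i
    using skew_upto_fix[OF assms(1)] assms(2) that by simp
  show "(T a i = a i) = (T b i = b i)" if "0 < i" for a b i
    by (rule skew_upto_base[OF assms(1) that])
  show "(T a 0 = a 0) = (T b 0 = b 0)" if "\<And>j. 0 < j \<Longrightarrow> j \<le> m \<Longrightarrow> a j = b j" for a b
    by (rule skew_upto_fibre[OF assms(1)]) (use that assms(2) in simp)
qed

lemma id_in_skew_upto: "id \<in> skew_upto n"
  by (rule skew_uptoI) auto

lemma skew_upto_base_agree:
  assumes "T \<in> skew_upto n" "0 < i" "a i = b i"
  shows "T a i = T b i"
  using skew_upto_base[OF assms(1,2), of a b] assms(3) by auto

text \<open>Sequences agreeing on the base coordinates up to \<open>n\<close> still agree there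
  after \<open>S\<close>, so the fibre shifts of both factors see the same data.\<close>

lemma skew_upto_comp:
  assumes T: "T \<in> skew_upto n" and S: "S \<in> skew_upto n"
  shows "T \<circ> S \<in> skew_upto n"
proof (rule skew_uptoI)
  show "(T \<circ> S) a i = a i" if "n < i" for a i
    using that skew_upto_fix[OF T] skew_upto_fix[OF S] by simp
  show "((T \<circ> S) a i = a i) = ((T \<circ> S) b i = b i)" if "0 < i" for a b i
    using skew_upto_base[OF T that, of "S a" "S b"] skew_upto_base[OF S that, of a b] by auto
  show "((T \<circ> S) a 0 = a 0) = ((T \<circ> S) b 0 = b 0)"
    if "\<And>j. 0 < j \<Longrightarrow> j \<le> n \<Longrightarrow> a j = b j" for a b
    using skew_upto_fibre[OF T, of "S a" "S b"] skew_upto_fibre[OF S, of a b]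
      skew_upto_base_agree[OF S, of _ a b] that by auto
qed

text \<open>The square fixes the base, so it adds to the fibre a function of the base, and hence is an involution.\<close>

lemma skew_upto_order:
  assumes T: "T \<in> skew_upto n"
  shows "T (T (T (T a))) = a"
proof
  fix i
  have base: "T (T b) j = b j" if "0 < j" for b j
    using skew_upto_base[OF T that, of b "T b"] by auto
  show "T (T (T (T a))) i = a i"
  proof (cases "i = 0")
    case True
    have "(T (T (T a)) 0 = T (T a) 0) = (T a 0 = a 0)"
      by (rule skew_upto_fibre[OF T]) (simp add: base)
    moreover have "(T (T (T (T a))) 0 = T (T (T a)) 0) = (T (T a) 0 = T a 0)"
      by (rule skew_upto_fibre[OF T]) (simp add: base)
    ultimately show ?thesis
      using True by auto
  qed (simp add: base)
qed

text \<open>An element is determined by the set \<open>H\<close> of base coordinates that it flips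
  and the family \<open>A\<close> of base patterns over which it flips the fibre.\<close>

lemma finite_skew_upto: "finite (skew_upto n)"
proof (rule finite_surj)
  show "finite (Pow {1..n} \<times> Pow (Pow {1..n}))" by simp
  show "skew_upto n \<subseteq> (\<lambda>(H, A) a i. a i \<noteq> (if i = 0 then {j\<in>{1..n}. a j} \<in> A else i \<in> H))
     ` (Pow {1..n} \<times> Pow (Pow {1..n}))"
  proof
    fix T assume T: "T \<in> skew_upto n"
    define H where "H = {i\<in>{1..n}. T (\<lambda>_. False) i}"
    \<comment> \<open>Each pattern is tested on its indicator sequence. As \<open>B\<close> omits 0,
      the condition \<open>0 \<in> B\<close> is false and merely records the original fibre
      value.\<close>
    define A where "A = {B\<in>Pow {1..n}. T (\<lambda>j. j \<in> B) 0 \<noteq> (0 \<in> B)}"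
    have "T a i = (a i \<noteq> (if i = 0 then {j\<in>{1..n}. a j} \<in> A else i \<in> H))" for a i
    proof (cases "i = 0")
      case True
      then show ?thesis
        using skew_upto_fibre[OF T, of a "\<lambda>j. j \<in> {j\<in>{1..n}. a j}"] by (auto simp: A_def)
    next
      case False
      then show ?thesis
        using skew_upto_base[OF T, of i a "\<lambda>_. False"] skew_upto_fix[OF T, of i a]
        by (cases "n < i") (auto simp: H_def)
    qed
    then have "T = (\<lambda>(H, A) a i. a i \<noteq> (if i = 0 then {j\<in>{1..n}. a j} \<in> A else i \<in> H)) (H, A)"
      by (simp add: fun_eq_iff)
    then show "T \<in> (\<lambda>(H, A) a i. a i \<noteq> (if i = 0 then {j\<in>{1..n}. a j} \<in> A else i \<in> H))
     ` (Pow {1..n} \<times> Pow (Pow {1..n}))"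
      by (rule image_eqI) (auto simp: H_def A_def)
  qed
qed

section \<open>The group of skew products and its failure of finite generation\<close>

text \<open>By compactness of the base, a locally constant function depends on finitely many
  coordinates, so the union contains all the intended skew products.\<close>

definition skew_group :: "((nat \<Rightarrow> bool) \<Rightarrow> nat \<Rightarrow> bool) monoid" where
  "skew_group = \<lparr>carrier = (\<Union>n. skew_upto n), mult = (\<circ>), one = id\<rparr>"

lemma skew_group_sel [simp]:
  "carrier skew_group = (\<Union>n. skew_upto n)"
  "T \<otimes>\<^bsub>skew_group\<^esub> S = T \<circ> S"
  "\<one>\<^bsub>skew_group\<^esub> = id"
  by (simp_all add: skew_group_def)

text \<open>Since the fourth power of \<open>T\<close> is the identity, its cube is an inverse, and
  it lies in the same \<open>skew_upto n\<close>.\<close>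

lemma skew_group_inverse:
  assumes "T \<in> skew_upto n"
  shows "T \<circ> T \<circ> T \<in> skew_upto n" "(T \<circ> T \<circ> T) \<circ> T = id" "T \<circ> (T \<circ> T \<circ> T) = id"
  by (intro skew_upto_comp assms) (simp_all add: fun_eq_iff skew_upto_order[OF assms])

lemma group_skew_group: "group skew_group"
proof (rule groupI)
  fix S T assume "S \<in> carrier skew_group" "T \<in> carrier skew_group"
  then obtain m n where "S \<in> skew_upto m" "T \<in> skew_upto n" by auto
  then have "S \<in> skew_upto (max m n)" "T \<in> skew_upto (max m n)"
    by (simp_all add: skew_upto_mono)
  then show "S \<otimes>\<^bsub>skew_group\<^esub> T \<in> carrier skew_group"
    by (auto intro: skew_upto_comp)
next
  fix T assume "T \<in> carrier skew_group"
  then obtain n where "T \<in> skew_upto n" by auto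
  then show "\<exists>S\<in>carrier skew_group. S \<otimes>\<^bsub>skew_group\<^esub> T = \<one>\<^bsub>skew_group\<^esub>"
    using skew_group_inverse(1,2)[of T n] by (intro bexI[of _ "T \<circ> T \<circ> T"]) auto
qed (simp_all add: o_assoc id_in_skew_upto)

lemma countable_skew_group: "countable (carrier skew_group)"
  by (simp add: countable_finite finite_skew_upto)

lemma subgroup_skew_upto: "subgroup (skew_upto n) skew_group"
proof -
  interpret group skew_group by (rule group_skew_group)
  show ?thesis
  proof (rule subgroupI)
    fix T assume T: "T \<in> skew_upto n"
    then have "inv\<^bsub>skew_group\<^esub> T = T \<circ> T \<circ> T"
      using skew_group_inverse[OF T] by (intro inv_equality) auto
    then show "inv\<^bsub>skew_group\<^esub> T \<in> skew_upto n"
      using skew_group_inverse(1)[OF T] by simp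
  qed (auto intro: skew_upto_comp id_in_skew_upto)
qed

text \<open>The fibre shift is the constant \<open>c 0\<close>. These elements yield dense orbits,
  and also elements outside any given \<open>skew_upto n\<close>.\<close>

lemma translation_in_skew_upto:
  "(\<lambda>x i. if i \<le> n then x i \<noteq> c i else x i) \<in> skew_upto n"
  by (rule skew_uptoI) auto

lemma not_finitely_generated_skew_group: "\<not> finitely_generated_group skew_group"
proof
  assume "finitely_generated_group skew_group"
  then obtain S where S: "finite S" "S \<subseteq> carrier skew_group"
      "generate skew_group S = carrier skew_group"
    by (auto simp: finitely_generated_group_def)
  have "\<exists>n. S \<subseteq> skew_upto n"
    using S(1,2)
  proof induction
    case (insert T S)
    then obtain m n where "T \<in> skew_upto m" "S \<subseteq> skew_upto n" by auto
    then have "insert T S \<subseteq> skew_upto (max m n)"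
      by (auto intro: skew_upto_mono)
    then show ?case ..
  qed simp
  then obtain n where "S \<subseteq> skew_upto n" ..
  then have "carrier skew_group \<subseteq> skew_upto n"
    using group.generate_subgroup_incl[OF group_skew_group _ subgroup_skew_upto] S(3) by metis
  \<comment> \<open>This translation moves coordinate \<open>Suc n\<close>, which every element of
    \<open>skew_upto n\<close> fixes.\<close>
  then have "(\<lambda>x i. if i \<le> Suc n then x i \<noteq> True else x i) \<in> skew_upto n"
    using translation_in_skew_upto[of "Suc n" "\<lambda>_. True"]
    unfolding skew_group_sel by blast
  from skew_upto_fix[OF this, of "Suc n"] show False by auto
qed

section \<open>Transfer of the action to the Cantor set\<close>

text \<open>Restricting to \<open>cantor_set\<close> makes the map extensional, as
  \<open>Homeo\<close> demands.\<close>

definition cantor_conj :: "((nat \<Rightarrow> bool) \<Rightarrow> nat \<Rightarrow> bool) \<Rightarrow> real \<Rightarrow> real" where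
  "cantor_conj T = (\<lambda>x\<in>cantor_set. cantor_map (T (inv_into UNIV cantor_map x)))"

lemma cantor_conj_apply [simp]: "cantor_conj T (cantor_map a) = cantor_map (T a)"
  by (simp add: cantor_conj_def cantor_set_eq inj_cantor_map)

lemma cantor_conj_comp: "cantor_conj (T \<circ> S) = compose cantor_set (cantor_conj T) (cantor_conj S)"
  by (rule extensionalityI[of _ cantor_set])
    (auto simp: cantor_set_eq compose_def cantor_conj_def inj_cantor_map)

lemma continuous_on_cantor_conj:
  assumes T: "T \<in> skew_upto n"
  shows "continuous_on cantor_set (cantor_conj T)"
  unfolding continuous_on_iff
proof (intro ballI allI impI)
  fix x and e :: real assume "x \<in> cantor_set" "0 < e"
  then obtain a where a: "x = cantor_map a" by (auto simp: cantor_set_eq)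
  obtain k where k: "1 / 3 ^ k < e"
    using real_arch_pow_inv[of e "1/3"] \<open>0 < e\<close> by (auto simp: power_divide)
  \<comment> \<open>\<open>k\<close> gives the accuracy; \<open>Suc n\<close> ensures that agreement
    below \<open>m\<close> covers the coordinates up to \<open>n\<close>, on which the fibre shift
    depends.\<close>
  define m where "m = max k (Suc n)"
  have "dist (cantor_conj T y) (cantor_conj T x) < e"
    if "y \<in> cantor_set" "dist y x < 1 / 3 ^ m" for y
  proof -
    obtain b where b: "y = cantor_map b" using \<open>y \<in> cantor_set\<close> by (auto simp: cantor_set_eq)
    have agree: "b i = a i" if "i < m" for i
    proof (rule ccontr)
      assume "b i \<noteq> a i"
      from dist_cantor_map_ge[of b i a, OF this] have "1 / 3 ^ Suc i < (1::real) / 3 ^ m"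
        using \<open>dist y x < 1 / 3 ^ m\<close> by (simp add: a b)
      moreover have "(1::real) / 3 ^ m \<le> 1 / 3 ^ Suc i"
        using \<open>i < m\<close> by (intro divide_left_mono power_increasing) auto
      ultimately show False by simp
    qed
    have "T b i = T a i" if "i < m" for i
      using skew_upto_base_agree[OF T, of i b a] skew_upto_fibre[OF T, of b a] agree that
      by (cases "i = 0") (auto simp: m_def)
    then have "dist (cantor_map (T b)) (cantor_map (T a)) \<le> 1 / 3 ^ m"
      by (rule dist_cantor_map_le)
    also have "\<dots> \<le> 1 / 3 ^ k"
      by (intro divide_left_mono power_increasing) (auto simp: m_def)
    finally show ?thesis using k by (simp add: a b)
  qed
  then show "\<exists>d>0. \<forall>y\<in>cantor_set. dist y x < d \<longrightarrow> dist (cantor_conj T y) (cantor_conj T x) < e"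
    by (intro exI[of _ "1 / 3 ^ m"]) auto
qed

lemma cantor_conj_in_Homeo:
  assumes T: "T \<in> skew_upto n"
  shows "cantor_conj T \<in> carrier (Homeo cantor_set)"
proof -
  have "homeomorphism cantor_set cantor_set (cantor_conj T) (cantor_conj (T \<circ> T \<circ> T))"
    using continuous_on_cantor_conj[OF T] continuous_on_cantor_conj[OF skew_group_inverse(1)[OF T]]
    by (rule homeomorphismI) (auto simp: cantor_set_eq skew_upto_order[OF T])
  then show ?thesis
    by (auto simp: Homeo_def cantor_conj_def)
qed

lemma cantor_conj_hom: "cantor_conj \<in> hom skew_group (Homeo cantor_set)"
proof (rule homI)
  fix S T assume "S \<in> carrier skew_group" "T \<in> carrier skew_group"
  then have "cantor_conj S \<in> Bij cantor_set" "cantor_conj T \<in> Bij cantor_set"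
    using cantor_conj_in_Homeo Homeo_carrier_subset by (fastforce simp: Homeo_def)+
  then show "cantor_conj (S \<otimes>\<^bsub>skew_group\<^esub> T)
      = cantor_conj S \<otimes>\<^bsub>Homeo cantor_set\<^esub> cantor_conj T"
    by (simp add: Homeo_def BijGroup_def cantor_conj_comp)
qed (use cantor_conj_in_Homeo in auto)

section \<open>Minimality, distality and expansiveness\<close>

lemma minimal_cantor_conj: "minimal_action skew_group cantor_set cantor_conj"
  unfolding minimal_action_def
proof (intro allI impI, elim conjE)
  fix Y assume closed: "closedin (top_of_set cantor_set) Y" and "Y \<noteq> {}"
    and inv: "\<forall>T\<in>carrier skew_group. cantor_conj T ` Y \<subseteq> Y"
  have "closed Y" and Y: "Y \<subseteq> cantor_set"
    using closedin_closed_trans[OF closed compact_imp_closed[OF compact_cantor_set]]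
      closedin_imp_subset[OF closed] by auto
  with \<open>Y \<noteq> {}\<close> obtain a where a: "cantor_map a \<in> Y" by (auto simp: cantor_set_eq)
  have "cantor_map z \<in> Y" for z
  proof -
    have "\<exists>y\<in>Y. dist y (cantor_map z) < e" if "0 < e" for e
    proof -
      obtain k where k: "1 / 3 ^ k < e"
        using real_arch_pow_inv[of e "1/3"] \<open>0 < e\<close> by (auto simp: power_divide)
      \<comment> \<open>Flipping exactly where \<open>a\<close> and \<open>z\<close> differ turns
        \<open>a\<close> into \<open>z\<close> on the coordinates up to \<open>k\<close>.\<close>
      define T where "T = (\<lambda>x i. if i \<le> k then x i \<noteq> (a i \<noteq> z i) else x i)"
      have "T \<in> skew_upto k"
        unfolding T_def by (rule translation_in_skew_upto)
      then have "cantor_conj T ` Y \<subseteq> Y"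
        using inv by auto
      then have "cantor_conj T (cantor_map a) \<in> Y"
        using a by blast
      moreover have "dist (cantor_map (T a)) (cantor_map z) \<le> 1 / 3 ^ k"
        by (rule dist_cantor_map_le) (auto simp: T_def)
      ultimately show ?thesis
        using k by (intro bexI[of _ "cantor_map (T a)"]) auto
    qed
    then show ?thesis
      using \<open>closed Y\<close> by (metis closed_approachable)
  qed
  then show "Y = cantor_set"
    using Y by (auto simp: cantor_set_eq)
qed

lemma distal_cantor_conj: "distal_action skew_group cantor_set cantor_conj"
  unfolding distal_action_def
proof (intro ballI impI)
  fix x y assume "x \<in> cantor_set" "y \<in> cantor_set" "x \<noteq> y"
  then obtain a b where ab: "x = cantor_map a" "y = cantor_map b" "a \<noteq> b"
    by (auto simp: cantor_set_eq)
  \<comment> \<open>One coordinate separates the images under the whole group: a base coordinate if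
    the bases differ, and otherwise the fibre coordinate 0.\<close>
  have "\<exists>m. \<forall>T\<in>carrier skew_group. T a m \<noteq> T b m"
  proof (cases "\<exists>m>0. a m \<noteq> b m")
    case True
    then obtain m where m: "0 < m" "a m \<noteq> b m" by blast
    have "T a m \<noteq> T b m" if "T \<in> skew_upto n" for T n
      using skew_upto_base[OF that m(1), of a b] m(2) by auto
    then show ?thesis by auto
  next
    case False
    have 0: "a 0 \<noteq> b 0"
    proof
      assume "a 0 = b 0"
      with False have "a i = b i" for i by (cases "i = 0") blast+
      with \<open>a \<noteq> b\<close> show False by blast
    qed
    have "T a 0 \<noteq> T b 0" if "T \<in> skew_upto n" for T n
    proof -
      have "(T a 0 = a 0) = (T b 0 = b 0)"
        by (rule skew_upto_fibre[OF that]) (use False in blast)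
      with 0 show ?thesis by auto
    qed
    then show ?thesis by auto
  qed
  then obtain m where m: "\<And>T. T \<in> carrier skew_group \<Longrightarrow> T a m \<noteq> T b m" by blast
  have "(0::real) < 1 / 3 ^ Suc m" by simp
  also have "\<dots> \<le> (INF T\<in>carrier skew_group. dist (cantor_conj T x) (cantor_conj T y))"
  proof (rule cINF_greatest)
    show "carrier skew_group \<noteq> {}" using id_in_skew_upto by auto
    show "1 / 3 ^ Suc m \<le> dist (cantor_conj T x) (cantor_conj T y)"
      if "T \<in> carrier skew_group" for T
      using dist_cantor_map_ge[of "T a" m "T b"] m[OF that] by (simp add: ab)
  qed
  finally show "0 < (INF T\<in>carrier skew_group. dist (cantor_conj T x) (cantor_conj T y))" .
qed

lemma expansive_cantor_conj: "expansive_action skew_group cantor_set cantor_conj"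
  unfolding expansive_action_def
\<comment> \<open>Any positive constant below 1/3 would do: sequences differing at coordinate 0 have
  images at distance at least 1/3.\<close>
proof (intro exI[of _ "1 / 4"] conjI ballI impI)
  fix x y assume "x \<in> cantor_set" "y \<in> cantor_set" "x \<noteq> y"
  then obtain a b where ab: "x = cantor_map a" "y = cantor_map b" "a \<noteq> b"
    by (auto simp: cantor_set_eq)
  obtain T where T: "T \<in> carrier skew_group" "T a 0 \<noteq> T b 0"
  proof (cases "a 0 = b 0")
    case True
    from \<open>a \<noteq> b\<close> obtain m where m: "a m \<noteq> b m" by blast
    with True have "m \<noteq> 0" by metis
    \<comment> \<open>Adding coordinate \<open>m\<close> to the fibre copies the difference at
      \<open>m\<close> into coordinate 0, where \<open>a\<close> and \<open>b\<close> agree.\<close>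
    then have "(\<lambda>x. x(0 := x 0 \<noteq> x m)) \<in> skew_upto m"
      by (intro skew_uptoI) auto
    then show thesis
      by (rule_tac that[of "\<lambda>x. x(0 := x 0 \<noteq> x m)"]) (use True m in auto)
  next
    case False
    then show thesis using that[of id] id_in_skew_upto by auto
  qed
  have "(1/4 :: real) < 1 / 3 ^ Suc 0" by simp
  also have "\<dots> \<le> dist (cantor_conj T x) (cantor_conj T y)"
    using dist_cantor_map_ge[of "T a" 0 "T b"] T(2) by (simp add: ab)
  also have "\<dots> \<le> (SUP T\<in>carrier skew_group. dist (cantor_conj T x) (cantor_conj T y))"
  proof (rule cSUP_upper[OF T(1)])
    show "bdd_above ((\<lambda>T. dist (cantor_conj T x) (cantor_conj T y)) ` carrier skew_group)"
      using dist_cantor_map_le[of 0] by (auto simp: ab intro!: bdd_aboveI2[of _ _ 1])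
  qed
  finally show "1 / 4 < (SUP T\<in>carrier skew_group. dist (cantor_conj T x) (cantor_conj T y))" .
qed simp

section \<open>Transport to a group of natural numbers\<close>

lemma finitely_generated_group_iso:
  assumes "finitely_generated_group G" "group H" "h \<in> iso G H"
  shows "finitely_generated_group H"
proof -
  from assms(1) obtain S where S: "group G" "finite S" "S \<subseteq> carrier G" "generate G S = carrier G"
    by (auto simp: finitely_generated_group_def)
  interpret group_hom G H h
    using S(1) assms by (simp add: group_hom_def group_hom_axioms_def iso_def)
  have "h ` carrier G = carrier H"
    using assms(3) by (auto simp: iso_def bij_betw_def)
  then show ?thesis
    using generate_img[OF S(3)] S assms(2) unfolding finitely_generated_group_def
    by (metis finite_imageI image_mono)
qed

theorem mainTheorem2:
  shows "\<exists>(G :: nat monoid) (\<phi> :: nat \<Rightarrow> real \<Rightarrow> real).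
    group G \<and> countable (carrier G) \<and> \<not> finitely_generated_group G \<and>
    continuous_action G cantor_set \<phi> \<and>
    minimal_action G cantor_set \<phi> \<and>
    distal_action G cantor_set \<phi> \<and>
    expansive_action G cantor_set \<phi>"
proof -
  interpret \<Gamma>: group skew_group by (rule group_skew_group)
  \<comment> \<open>An injective numbering of the countable carrier; the group structure is carried
    along it to get a group on \<open>nat\<close>.\<close>
  define c where "c = to_nat_on (carrier skew_group)"
  define G where "G = image_group c skew_group"
  have inj: "inj_on c (carrier skew_group)"
    unfolding c_def by (rule inj_on_to_nat_on[OF countable_skew_group])
  have iso: "c \<in> iso skew_group G" and G: "group G"
    unfolding G_def
    by (rule inj_imp_image_group_iso[OF inj], rule \<Gamma>.inj_imp_image_group_is_group[OF inj])
  define d where "d = inv_into (carrier skew_group) c"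
  have d: "d \<in> iso G skew_group"
    unfolding d_def by (rule \<Gamma>.iso_set_sym[OF iso])
  define \<phi> where "\<phi> = cantor_conj \<circ> d"
  \<comment> \<open>Minimality, distality and expansiveness depend only on the set of acting maps,
    so this reindexing of the carrier transfers them to \<open>\<phi>\<close>.\<close>
  have carrier: "carrier skew_group = d ` carrier G"
    using d by (auto simp: iso_def bij_betw_def)
  have "\<not> finitely_generated_group G"
    using finitely_generated_group_iso[OF _ group_skew_group d] not_finitely_generated_skew_group
    by blast
  moreover have "continuous_action G cantor_set \<phi>"
    unfolding continuous_action_def \<phi>_def
    using G compact_cantor_set d cantor_conj_hom
    by (auto simp: iso_def intro: hom_compose)
  moreover have "minimal_action G cantor_set \<phi>"
    using minimal_cantor_conj unfolding minimal_action_def carrier \<phi>_def by simp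
  moreover have "distal_action G cantor_set \<phi>"
    using distal_cantor_conj unfolding distal_action_def carrier \<phi>_def by (simp add: image_comp o_def)
  moreover have "expansive_action G cantor_set \<phi>"
    using expansive_cantor_conj unfolding expansive_action_def carrier \<phi>_def
    by (simp add: image_comp o_def)
  ultimately show ?thesis
    using G by auto
qed

end
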